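(* Let $G$ be a finite additive abelian group, $\Sigma=(\Gamma,\sigma)$ an unbalanced signed graph with underlying graph $\Gamma=(V,E)$, $\omega$ an orientation compatible with $\sigma$, and $f$ a $G$-tension of $\Sigma$. Let $\delta:G^V\to G^E$ be defined by $(\delta g)(e)=\omega(v,e)g(v)+\omega(u,e)g(u)$ for each edge $e$ with half-edges $(u,e),(v,e)$. Then $f$ lies in the image of $\delta$ if and only if $\sum_{e\in E(X)}f(e)\in 2G$ for every unbalanced cycle $X$ of $\Sigma$. Consequently, $f$ lies in the image of $\delta$ if and only if $f$ is a $G$-potential difference.
   Context: A signed graph $\Sigma=(\Gamma,\sigma)$: finite graph $\Gamma=(V,E)$ (loops, multiple edges allowed), $\sigma:E\to\{-1,1\}$. A cycle (loops included) is balanced if the product of its edge signs is $1$, unbalanced otherwise; $\Sigma$ is unbalanced if it has an unbalanced cycle. $E(X)$ is the edge set of the cycle $X$. Each edge $e$ with endpoints $u,v$ has half-edges $(u,e),(v,e)$ (a loop at $v$ has two at $v$); an orientation $\omega$ assigns $\pm1$ to each half-edge, compatible with $\sigma$ if $\sigma(e)=-\omega(u,e)\omega(v,e)$. A walk $(v_1,e_1,\dots,v_k,e_k,v_{k+1})$ has $e_i$ joining $v_i,v_{i+1}$; $\omega(v_i,e_i)$ is the orientation of the half-edge of $e_i$ at $v_i$ by which the walk leaves $v_i$. Circuits of $\Sigma$: edge sets of balanced cycles, of unbalanced tight handcuffs (two unbalanced cycles sharing exactly one vertex) and of unbalanced loose handcuffs (two vertex-disjoint unbalanced cycles joined by a path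 meeting them only at its endpoints, whose edges are circuit path edges). A circuit walk is a closed walk traversing a circuit using circuit path edges twice and other edges once. $f:E\to G$ is a $G$-tension if for every circuit walk $(v_1,e_1,\dots,v_k,e_k,v_1)$, $\sum_{i=1}^k\big(\omega(v_i,e_i)\prod_{j<i}\sigma(e_j)\big)f(e_i)=0$; a $G$-potential difference if additionally $\sum_if(e_i)\in 2G=\{x+x:x\in G\}$ for every closed walk $(v_1,e_1,\dots,e_k,v_1)$ around an unbalanced cycle. *)

theory Defs
  imports Main "HOL-Library.FuncSet"
begin

text \<open>Every edge \<open>e\<close> has exactly the two half-edges \<open>(e, False)\<close> and \<open>(e, True)\<close>, attached at
  \<open>endpt (e, False)\<close> and \<open>endpt (e, True)\<close>; these vertices coincide for a loop.  The labels carry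
  no direction: all notions below are invariant under exchanging them.\<close>

type_synonym 'e half_edge = "'e \<times> bool"

record ('v, 'e) multigraph =
  verts :: "'v set"
  edges :: "'e set"
  endpt :: "'e half_edge \<Rightarrow> 'v"

definition opp :: "'e half_edge \<Rightarrow> 'e half_edge" where
  "opp h = (fst h, \<not> snd h)"

definition signed_graph :: "('v, 'e) multigraph \<Rightarrow> ('e \<Rightarrow> int) \<Rightarrow> bool" where
  "signed_graph \<Gamma> \<sigma> \<longleftrightarrow>
     finite (verts \<Gamma>) \<and> finite (edges \<Gamma>) \<and>
     (\<forall>e\<in>edges \<Gamma>. \<forall>b. endpt \<Gamma> (e, b) \<in> verts \<Gamma>) \<and>
     (\<forall>e\<in>edges \<Gamma>. \<sigma> e \<in> {-1, 1})"

definition compatible_orientation ::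
    "('v, 'e) multigraph \<Rightarrow> ('e \<Rightarrow> int) \<Rightarrow> ('e half_edge \<Rightarrow> int) \<Rightarrow> bool" where
  "compatible_orientation \<Gamma> \<sigma> \<omega> \<longleftrightarrow>
     (\<forall>e\<in>edges \<Gamma>. (\<forall>b. \<omega> (e, b) \<in> {-1, 1}) \<and> \<sigma> e = - (\<omega> (e, False) * \<omega> (e, True)))"

text \<open>A walk \<open>(v\<^sub>1, e\<^sub>1, \<dots>, v\<^sub>k, e\<^sub>k, v\<^sub>k\<^sub>+\<^sub>1)\<close> is encoded by the list of the half-edges by which it
  leaves \<open>v\<^sub>1, \<dots>, v\<^sub>k\<close>; the step along \<open>h\<close> arrives by \<open>opp h\<close>.  This also records in which
  direction a loop is traversed.\<close>

fun walk :: "('v, 'e) multigraph \<Rightarrow> 'v \<Rightarrow> 'e half_edge list \<Rightarrow> 'v \<Rightarrow> bool" where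
  "walk \<Gamma> u [] w \<longleftrightarrow> u \<in> verts \<Gamma> \<and> u = w"
| "walk \<Gamma> u (h # hs) w \<longleftrightarrow>
     fst h \<in> edges \<Gamma> \<and> endpt \<Gamma> h = u \<and> walk \<Gamma> (endpt \<Gamma> (opp h)) hs w"

definition closed_walk :: "('v, 'e) multigraph \<Rightarrow> 'e half_edge list \<Rightarrow> bool" where
  "closed_walk \<Gamma> hs \<longleftrightarrow> hs \<noteq> [] \<and> (\<exists>v. walk \<Gamma> v hs v)"

definition path :: "('v, 'e) multigraph \<Rightarrow> 'v \<Rightarrow> 'e half_edge list \<Rightarrow> 'v \<Rightarrow> bool" where
  "path \<Gamma> u hs w \<longleftrightarrow> walk \<Gamma> u hs w \<and> distinct (map (endpt \<Gamma>) hs @ [w])"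

definition walk_edges :: "'e half_edge list \<Rightarrow> 'e set" where
  "walk_edges hs = fst ` set hs"

definition edge_verts :: "('v, 'e) multigraph \<Rightarrow> 'e set \<Rightarrow> 'v set" where
  "edge_verts \<Gamma> X = {endpt \<Gamma> (e, b) | e b. e \<in> X}"

text \<open>A cycle has length at least 1 (a loop); distinctness of edges excludes going back and forth
  along a single edge.  A cycle \<open>X\<close> is identified with its edge set \<open>E(X)\<close>.\<close>

definition cycle_walk :: "('v, 'e) multigraph \<Rightarrow> 'e half_edge list \<Rightarrow> bool" where
  "cycle_walk \<Gamma> hs \<longleftrightarrow>
     closed_walk \<Gamma> hs \<and> distinct (map (endpt \<Gamma>) hs) \<and> distinct (map fst hs)"

definition is_cycle :: "('v, 'e) multigraph \<Rightarrow> 'e set \<Rightarrow> bool" where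
  "is_cycle \<Gamma> X \<longleftrightarrow> (\<exists>hs. cycle_walk \<Gamma> hs \<and> X = walk_edges hs)"

definition balanced_cycle :: "('v, 'e) multigraph \<Rightarrow> ('e \<Rightarrow> int) \<Rightarrow> 'e set \<Rightarrow> bool" where
  "balanced_cycle \<Gamma> \<sigma> X \<longleftrightarrow> is_cycle \<Gamma> X \<and> (\<Prod>e\<in>X. \<sigma> e) = 1"

definition unbalanced_cycle :: "('v, 'e) multigraph \<Rightarrow> ('e \<Rightarrow> int) \<Rightarrow> 'e set \<Rightarrow> bool" where
  "unbalanced_cycle \<Gamma> \<sigma> X \<longleftrightarrow> is_cycle \<Gamma> X \<and> (\<Prod>e\<in>X. \<sigma> e) \<noteq> 1"

definition unbalanced :: "('v, 'e) multigraph \<Rightarrow> ('e \<Rightarrow> int) \<Rightarrow> bool" where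
  "unbalanced \<Gamma> \<sigma> \<longleftrightarrow> (\<exists>X. unbalanced_cycle \<Gamma> \<sigma> X)"

text \<open>The condition \<open>X \<noteq> Y\<close> matters only when \<open>X\<close> and \<open>Y\<close> would be the same loop.\<close>

definition tight_handcuff :: "('v, 'e) multigraph \<Rightarrow> ('e \<Rightarrow> int) \<Rightarrow> 'e set \<Rightarrow> bool" where
  "tight_handcuff \<Gamma> \<sigma> C \<longleftrightarrow>
     (\<exists>X Y v. unbalanced_cycle \<Gamma> \<sigma> X \<and> unbalanced_cycle \<Gamma> \<sigma> Y \<and> X \<noteq> Y \<and>
        edge_verts \<Gamma> X \<inter> edge_verts \<Gamma> Y = {v} \<and> C = X \<union> Y)"

definition loose_handcuff ::
    "('v, 'e) multigraph \<Rightarrow> ('e \<Rightarrow> int) \<Rightarrow> 'e set \<Rightarrow> 'e set \<Rightarrow> bool" where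
  "loose_handcuff \<Gamma> \<sigma> C P \<longleftrightarrow>
     (\<exists>X Y u p w. unbalanced_cycle \<Gamma> \<sigma> X \<and> unbalanced_cycle \<Gamma> \<sigma> Y \<and>
        edge_verts \<Gamma> X \<inter> edge_verts \<Gamma> Y = {} \<and>
        path \<Gamma> u p w \<and> P = walk_edges p \<and>
        edge_verts \<Gamma> P \<inter> edge_verts \<Gamma> X = {u} \<and>
        edge_verts \<Gamma> P \<inter> edge_verts \<Gamma> Y = {w} \<and>
        C = X \<union> Y \<union> P)"

text \<open>\<open>circuit \<Gamma> \<sigma> C P\<close>: \<open>C\<close> is a circuit whose set of circuit path edges is \<open>P\<close>.\<close>

definition circuit :: "('v, 'e) multigraph \<Rightarrow> ('e \<Rightarrow> int) \<Rightarrow> 'e set \<Rightarrow> 'e set \<Rightarrow> bool" where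
  "circuit \<Gamma> \<sigma> C P \<longleftrightarrow>
     (balanced_cycle \<Gamma> \<sigma> C \<and> P = {}) \<or>
     (tight_handcuff \<Gamma> \<sigma> C \<and> P = {}) \<or>
     loose_handcuff \<Gamma> \<sigma> C P"

definition circuit_walk :: "('v, 'e) multigraph \<Rightarrow> ('e \<Rightarrow> int) \<Rightarrow> 'e half_edge list \<Rightarrow> bool" where
  "circuit_walk \<Gamma> \<sigma> hs \<longleftrightarrow>
     closed_walk \<Gamma> hs \<and>
     (\<exists>C P. circuit \<Gamma> \<sigma> C P \<and> walk_edges hs = C \<and>
        (\<forall>e\<in>C. count_list (map fst hs) e = (if e \<in> P then 2 else 1)))"

text \<open>The action of the signs \<open>1\<close> and \<open>-1\<close> on an abelian group; used for no other integers.\<close>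

definition sign_act :: "int \<Rightarrow> 'g::ab_group_add \<Rightarrow> 'g" (infixr "\<odot>" 75) where
  "s \<odot> x = (if s = 1 then x else - x)"

definition twice :: "'g::ab_group_add set" where
  "twice = {x + x | x. True}"

text \<open>\<open>G\<^sup>V\<close> and \<open>G\<^sup>E\<close> are the extensional function spaces \<open>verts \<Gamma> \<rightarrow>\<^sub>E UNIV\<close> and
  \<open>edges \<Gamma> \<rightarrow>\<^sub>E UNIV\<close>.\<close>

definition tension ::
    "('v, 'e) multigraph \<Rightarrow> ('e \<Rightarrow> int) \<Rightarrow> ('e half_edge \<Rightarrow> int) \<Rightarrow> ('e \<Rightarrow> 'g::ab_group_add) \<Rightarrow> bool"
  where
  "tension \<Gamma> \<sigma> \<omega> f \<longleftrightarrow>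
     f \<in> edges \<Gamma> \<rightarrow>\<^sub>E UNIV \<and>
     (\<forall>hs. circuit_walk \<Gamma> \<sigma> hs \<longrightarrow>
        (\<Sum>i<length hs. (\<omega> (hs ! i) * (\<Prod>j<i. \<sigma> (fst (hs ! j)))) \<odot> f (fst (hs ! i))) = 0)"

definition potential_difference ::
    "('v, 'e) multigraph \<Rightarrow> ('e \<Rightarrow> int) \<Rightarrow> ('e half_edge \<Rightarrow> int) \<Rightarrow> ('e \<Rightarrow> 'g::ab_group_add) \<Rightarrow> bool"
  where
  "potential_difference \<Gamma> \<sigma> \<omega> f \<longleftrightarrow>
     tension \<Gamma> \<sigma> \<omega> f \<and>
     (\<forall>hs. cycle_walk \<Gamma> hs \<and> unbalanced_cycle \<Gamma> \<sigma> (walk_edges hs) \<longrightarrow>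
        (\<Sum>i<length hs. f (fst (hs ! i))) \<in> twice)"

definition delta ::
    "('v, 'e) multigraph \<Rightarrow> ('e half_edge \<Rightarrow> int) \<Rightarrow> ('v \<Rightarrow> 'g::ab_group_add) \<Rightarrow> 'e \<Rightarrow> 'g" where
  "delta \<Gamma> \<omega> g =
     (\<lambda>e\<in>edges \<Gamma>. \<omega> (e, True) \<odot> g (endpt \<Gamma> (e, True)) + \<omega> (e, False) \<odot> g (endpt \<Gamma> (e, False)))"

end

theory Submission
  imports Defs
begin

text \<open>
  A walk \<open>p\<close> has a gain \<open>(T p, \<sigma> p)\<close> in the generalized dihedral group \<open>G \<rtimes> {1, -1}\<close>, where \<open>T p\<close> is
  the sum from the definition of a tension; gains multiply along concatenation and are inverted by
  reversal.  If every balanced closed walk has trivial gain, then all unbalanced closed walks at a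
  vertex \<open>r\<close> share one gain \<open>(t, -1)\<close>, where \<open>t\<close> is modulo \<open>2G\<close> the sum of \<open>f\<close> along the walk, so
  that \<open>t = 2x\<close> under the cycle condition.  The gains of all closed walks at \<open>r\<close> then fix \<open>x\<close>, and
  transporting \<open>x\<close> along walks from \<open>r\<close> defines a potential.

  That balanced closed walks have trivial gain is shown by induction on the length.  A shortest
  counterexample that is not a cycle splits into two unbalanced closed walks \<open>q\<close> and \<open>y\<close>, seen as a
  handcuff \<open>q z y z\<^sup>-\<^sup>1\<close> with empty \<open>z\<close>.  Any repeated vertex of such a handcuff produces shorter
  balanced closed walks, whose triviality either settles the claim or allows \<open>q\<close>, \<open>y\<close> or \<open>z\<close> to be
  shortened; once no reduction applies, the handcuff is a circuit.
\<close>

section \<open>Generalized dihedral group of gains\<close>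

datatype 'g gdih = GDih (transl: 'g) (flip: bool)

text \<open>\<open>GDih a s\<close> is the map \<open>x \<mapsto> a - x\<close> if \<open>s\<close> holds and \<open>x \<mapsto> a + x\<close> otherwise; addition is
  composition, so this is a non-commutative additive group.\<close>

instantiation gdih :: (ab_group_add) group_add
begin

definition "0 = GDih 0 False"

definition "x + y =
  GDih (if flip x then transl x - transl y else transl x + transl y) (flip x \<noteq> flip y)"

definition "- x = GDih (if flip x then transl x else - transl x) (flip x)"

definition "x - y = x + - (y :: 'a gdih)"

instance
  by standard
    (auto simp: zero_gdih_def plus_gdih_def uminus_gdih_def minus_gdih_def algebra_simps
      intro: gdih.expand)

end

lemma flip_zero [simp]: "\<not> flip 0"
  and flip_plus [simp]: "flip (x + y) \<longleftrightarrow> flip x \<noteq> flip y"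
  and flip_minus [simp]: "flip (- x) \<longleftrightarrow> flip x"
  by (auto simp: zero_gdih_def plus_gdih_def uminus_gdih_def)

lemma flip_diff [simp]: "flip (x - y) \<longleftrightarrow> flip x \<noteq> flip y"
  by (metis add_uminus_conv_diff flip_minus flip_plus)

lemma flip_add_self: "flip x \<Longrightarrow> x + x = 0"
  by (auto simp: zero_gdih_def plus_gdih_def)

definition act :: "'g::ab_group_add gdih \<Rightarrow> 'g \<Rightarrow> 'g" where
  "act s x = (if flip s then transl s - x else transl s + x)"

lemma act_zero [simp]: "act 0 x = x"
  by (simp add: act_def zero_gdih_def)

lemma act_plus: "act (s + t) x = act s (act t x)"
  by (simp add: act_def plus_gdih_def)

section \<open>Signs, doubles and reversed walks\<close>

lemma sign_act_one [simp]: "1 \<odot> x = x" "(-1) \<odot> x = - x"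
  by (auto simp: sign_act_def)

lemma twice_self [simp]: "x + x \<in> twice"
  by (auto simp: twice_def)

lemma twice_zero [simp]: "0 \<in> twice"
  using twice_self[of 0] by simp

lemma twice_add:
  assumes "a \<in> twice" "b \<in> twice"
  shows "a + b \<in> twice"
proof -
  obtain x y where "a = x + x" "b = y + y" using assms by (auto simp: twice_def)
  then have "a + b = (x + y) + (x + y)" by (simp add: algebra_simps)
  then show ?thesis using twice_self[of "x + y"] by simp
qed

lemma twice_uminus:
  assumes "a \<in> twice"
  shows "- a \<in> twice"
proof -
  obtain x where "a = x + x" using assms by (auto simp: twice_def)
  then show ?thesis using twice_self[of "- x"] by simp
qed

lemma sign_act_diff_twice: "s \<odot> a - a \<in> twice"
  using twice_uminus[OF twice_self[of a]] by (simp add: sign_act_def)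

lemma count_list_distinct: "distinct xs \<Longrightarrow> count_list xs x = (if x \<in> set xs then 1 else 0)"
  by (induction xs) auto

lemma opp_opp [simp]: "opp (opp h) = h"
  and fst_opp [simp]: "fst (opp h) = fst h"
  by (auto simp: opp_def)

lemma eq_or_opp: "fst h = fst k \<Longrightarrow> k = h \<or> k = opp h"
  by (cases h; cases k) (auto simp: opp_def)

definition wrev :: "'e half_edge list \<Rightarrow> 'e half_edge list" where
  "wrev p = rev (map opp p)"

lemma wrev_Nil [simp]: "wrev [] = []"
  and wrev_Cons [simp]: "wrev (h # p) = wrev p @ [opp h]"
  and length_wrev [simp]: "length (wrev p) = length p"
  by (auto simp: wrev_def)

lemma map_fst_wrev: "map fst (wrev p) = rev (map fst p)"
  by (simp add: wrev_def rev_map comp_def)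

text \<open>Rewriting with these rules loops unless \<open>add_uminus_conv_diff\<close> is removed from the simpset.\<close>

lemmas group_word = diff_conv_add_uminus add.assoc minus_add

lemma walk_edges_append [simp]: "walk_edges (p @ q) = walk_edges p \<union> walk_edges q"
  by (auto simp: walk_edges_def)

lemma walk_edges_wrev [simp]: "walk_edges (wrev p) = walk_edges p"
  using arg_cong[OF map_fst_wrev, of set p] by (simp add: walk_edges_def)

section \<open>Gains of walks\<close>

locale tension_graph =
  fixes \<Gamma> :: "('v, 'e) multigraph"
    and \<sigma> :: "'e \<Rightarrow> int"
    and \<omega> :: "'e half_edge \<Rightarrow> int"
    and f :: "'e \<Rightarrow> 'g::ab_group_add"
  assumes signed: "signed_graph \<Gamma> \<sigma>"
    and compatible: "compatible_orientation \<Gamma> \<sigma> \<omega>"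
    and tension: "tension \<Gamma> \<sigma> \<omega> f"
begin

text \<open>For a step along \<open>e\<close> from \<open>u\<close> to \<open>v\<close>, the edge
  equation of \<open>delta\<close> solved for the value at \<open>u\<close> reads
  \<open>g u = \<omega> h \<odot> f e + \<sigma> e \<odot> g v\<close>, which is this element acting
  on \<open>g v\<close>.\<close>

definition step_gain :: "'e half_edge \<Rightarrow> 'g gdih" where
  "step_gain h = GDih (\<omega> h \<odot> f (fst h)) (\<sigma> (fst h) = -1)"

definition gain :: "'e half_edge list \<Rightarrow> 'g gdih" where
  "gain p = sum_list (map step_gain p)"

lemma gain_Nil [simp]: "gain [] = 0"
  and gain_Cons: "gain (h # p) = step_gain h + gain p"
  and gain_append [simp]: "gain (p @ q) = gain p + gain q"
  by (auto simp: gain_def)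

lemma sign_cases: "e \<in> edges \<Gamma> \<Longrightarrow> \<sigma> e = 1 \<or> \<sigma> e = -1"
  using signed by (auto simp: signed_graph_def)

lemma orientation_cases: "fst h \<in> edges \<Gamma> \<Longrightarrow> \<omega> h = 1 \<or> \<omega> h = -1"
  using compatible by (cases h) (auto simp: compatible_orientation_def)

lemma orientation_opp: "fst h \<in> edges \<Gamma> \<Longrightarrow> \<omega> (opp h) = - (\<sigma> (fst h) * \<omega> h)"
proof -
  assume h: "fst h \<in> edges \<Gamma>"
  obtain e b where e: "h = (e, b)" by (cases h)
  have "\<sigma> e = - (\<omega> (e, False) * \<omega> (e, True))"
    using compatible h e by (auto simp: compatible_orientation_def)
  moreover have "\<omega> (e, False) = 1 \<or> \<omega> (e, False) = -1" "\<omega> (e, True) = 1 \<or> \<omega> (e, True) = -1"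
    using orientation_cases h e by auto
  ultimately show ?thesis using e by (cases b) (auto simp: opp_def)
qed

lemma endpt_in_verts: "fst h \<in> edges \<Gamma> \<Longrightarrow> endpt \<Gamma> h \<in> verts \<Gamma>"
  using signed by (cases h) (auto simp: signed_graph_def)

text \<open>On a negative edge both half-edges have the same orientation and a reflection is its own
  inverse; on a positive edge the orientation changes sign, which inverts the translation.\<close>

lemma step_gain_opp: "fst h \<in> edges \<Gamma> \<Longrightarrow> step_gain (opp h) = - step_gain h"
  using sign_cases[of "fst h"] orientation_cases[of h] orientation_opp[of h]
  by (auto simp: step_gain_def uminus_gdih_def)

section \<open>Splitting walks at vertices\<close>

lemma walk_in_verts: "walk \<Gamma> u p w \<Longrightarrow> u \<in> verts \<Gamma> \<and> w \<in> verts \<Gamma>"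
  by (induction p arbitrary: u) (auto simp: endpt_in_verts)

lemma walk_edges_subset: "walk \<Gamma> u p w \<Longrightarrow> h \<in> set p \<Longrightarrow> fst h \<in> edges \<Gamma>"
  by (induction p arbitrary: u) auto

lemma walk_append: "walk \<Gamma> u (p @ q) w \<longleftrightarrow> (\<exists>t. walk \<Gamma> u p t \<and> walk \<Gamma> t q w)"
  by (induction p arbitrary: u) (auto dest: walk_in_verts)

lemma walk_appendI: "walk \<Gamma> u p t \<Longrightarrow> walk \<Gamma> t q w \<Longrightarrow> walk \<Gamma> u (p @ q) w"
  by (auto simp: walk_append)

lemma walk_wrev: "walk \<Gamma> u p w \<Longrightarrow> walk \<Gamma> w (wrev p) u"
  by (induction p arbitrary: u) (auto simp: walk_append endpt_in_verts)

lemma gain_wrev: "walk \<Gamma> u p w \<Longrightarrow> gain (wrev p) = - gain p"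
  by (induction p arbitrary: u) (auto simp: gain_Cons step_gain_opp group_word simp del: add_uminus_conv_diff)

lemma walk_first: "walk \<Gamma> u p w \<Longrightarrow> p \<noteq> [] \<Longrightarrow> endpt \<Gamma> (hd p) = u"
  by (cases p) auto

lemma walk_split_at:
  assumes "walk \<Gamma> u p w" "t \<in> set (map (endpt \<Gamma>) p @ [w])"
  obtains a b where "p = a @ b" "walk \<Gamma> u a t" "walk \<Gamma> t b w"
    "t \<in> endpt \<Gamma> ` set p \<Longrightarrow> b \<noteq> []"
proof (cases "t \<in> endpt \<Gamma> ` set p")
  case True
  then obtain h where "h \<in> set p" "t = endpt \<Gamma> h" by auto
  then obtain a b where p: "p = a @ h # b" by (meson split_list)
  then obtain s where "walk \<Gamma> u a s" "walk \<Gamma> s (h # b) w" using assms(1) by (auto simp: walk_append)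
  then show ?thesis using that[of a "h # b"] p \<open>t = endpt \<Gamma> h\<close> by auto
next
  case False
  then have "t = w" using assms by auto
  then show ?thesis using that[of p "[]"] assms walk_in_verts False by auto
qed

text \<open>Only vertices that the steps leave are compared, so the return of a closed walk to its
  start is no repetition; \<open>walk_repeat_end\<close> counts the end vertex too.\<close>

lemma walk_repeat:
  assumes "walk \<Gamma> u p w" "\<not> distinct (map (endpt \<Gamma>) p)"
  obtains a b d t where "p = a @ b @ d" "b \<noteq> []" "d \<noteq> []"
    "walk \<Gamma> u a t" "walk \<Gamma> t b t" "walk \<Gamma> t d w"
proof -
  obtain xs ys zs y where "map (endpt \<Gamma>) p = xs @ [y] @ ys @ [y] @ zs"
    using assms(2) not_distinct_decomp by blast
  then obtain a h b k d where p: "p = a @ (h # b) @ (k # d)" and hk: "endpt \<Gamma> h = y" "endpt \<Gamma> k = y"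
    by (fastforce simp: map_eq_append_conv append_eq_map_conv Cons_eq_map_conv)
  have "walk \<Gamma> u a y" "walk \<Gamma> y (h # b) y" "walk \<Gamma> y (k # d) w"
    using assms(1) hk unfolding p walk_append by auto
  then show ?thesis using that[OF p] by auto
qed

lemma walk_repeat_end:
  assumes "walk \<Gamma> u p w" "\<not> distinct (map (endpt \<Gamma>) p @ [w])"
  obtains a b d t where "p = a @ b @ d" "b \<noteq> []" "walk \<Gamma> u a t" "walk \<Gamma> t b t" "walk \<Gamma> t d w"
proof (cases "distinct (map (endpt \<Gamma>) p)")
  case True
  then have w: "w \<in> endpt \<Gamma> ` set p" using assms by auto
  then have "w \<in> set (map (endpt \<Gamma>) p @ [w])" by simp
  from walk_split_at[OF assms(1) this]
  obtain a b where "p = a @ b" "walk \<Gamma> u a w" "walk \<Gamma> w b w" "b \<noteq> []" using w by metis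
  then show ?thesis using that[of a b "[]" w] walk_in_verts by simp
next
  case False
  then show ?thesis using walk_repeat[OF assms(1)] that by metis
qed

section \<open>Simple paths and simple closed walks\<close>

lemma edge_verts_walk:
  assumes "walk \<Gamma> u p w" "p \<noteq> []"
  shows "edge_verts \<Gamma> (walk_edges p) = set (map (endpt \<Gamma>) p @ [w])"
  using assms
proof (induction p arbitrary: u)
  case (Cons h p)
  have h: "{endpt \<Gamma> (fst h, b) | b. True} = {endpt \<Gamma> h, endpt \<Gamma> (opp h)}"
    by (cases h; cases "snd h") (auto simp: opp_def ex_bool_eq)
  have split: "edge_verts \<Gamma> (walk_edges (h # p)) =
      {endpt \<Gamma> (fst h, b) | b. True} \<union> edge_verts \<Gamma> (walk_edges p)"
    by (auto simp: edge_verts_def walk_edges_def)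
  show ?case
  proof (cases "p = []")
    case True
    then show ?thesis using Cons.prems unfolding split h by (auto simp: edge_verts_def walk_edges_def)
  next
    case False
    have p: "walk \<Gamma> (endpt \<Gamma> (opp h)) p w" using Cons.prems by simp
    then have "endpt \<Gamma> (opp h) \<in> endpt \<Gamma> ` set p" 
      using walk_first[OF p False] hd_in_set[OF False] image_eqI by metis
    then show ?thesis using Cons.IH[OF p False] unfolding split h by auto
  qed
qed simp

lemma edge_verts_closed:
  assumes "walk \<Gamma> u q u" "q \<noteq> []"
  shows "edge_verts \<Gamma> (walk_edges q) = endpt \<Gamma> ` set q"
proof -
  have "u \<in> endpt \<Gamma> ` set q" 
    using walk_first[OF assms] hd_in_set[OF assms(2)] image_eqI by metis
  then show ?thesis using edge_verts_walk[OF assms] by auto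
qed

lemma walk_start: "walk \<Gamma> u p w \<Longrightarrow> u \<in> set (map (endpt \<Gamma>) p @ [w])"
  by (cases p) auto

lemma path_distinct_edges:
  assumes "walk \<Gamma> u p w" "distinct (map (endpt \<Gamma>) p @ [w])"
  shows "distinct (map fst p)"
  using assms
proof (induction p arbitrary: u)
  case (Cons h p)
  have p: "walk \<Gamma> (endpt \<Gamma> (opp h)) p w" using Cons.prems by simp
  have "fst h \<notin> fst ` set p"
  proof
    assume e: "fst h \<in> fst ` set p"
    then have "endpt \<Gamma> h \<in> edge_verts \<Gamma> (walk_edges p)"
      by (cases h) (auto simp: edge_verts_def walk_edges_def)
    moreover have "p \<noteq> []" using e by auto
    ultimately show False using edge_verts_walk[OF p] Cons.prems(2) by auto
  qed
  then show ?case using Cons.IH[OF p] Cons.prems(2) by auto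
qed simp

lemma path_no_loop:
  assumes "walk \<Gamma> u p w" "distinct (map (endpt \<Gamma>) p @ [w])" "h \<in> set p"
  shows "endpt \<Gamma> (opp h) \<noteq> endpt \<Gamma> h"
  using assms
proof (induction p arbitrary: u)
  case (Cons k p)
  have p: "walk \<Gamma> (endpt \<Gamma> (opp k)) p w" using Cons.prems by simp
  have "endpt \<Gamma> k \<notin> set (map (endpt \<Gamma>) p @ [w])" using Cons.prems(2) by simp
  then have "endpt \<Gamma> (opp k) \<noteq> endpt \<Gamma> k" using walk_start[OF p] by metis
  then show ?case using Cons.IH[OF p] Cons.prems by auto
qed simp

text \<open>Removing the first step leaves a path, and paths contain no loops; so the loop is the
  first step, and a path back to its own start is empty.\<close>

lemma simple_closed_loop:
  assumes "walk \<Gamma> u q u" "distinct (map (endpt \<Gamma>) q)" "h \<in> set q" "endpt \<Gamma> (opp h) = endpt \<Gamma> h"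
  shows "q = [h]"
proof -
  obtain k p where q: "q = k # p" using assms(3) by (cases q) auto
  have p: "walk \<Gamma> (endpt \<Gamma> (opp k)) p u" "distinct (map (endpt \<Gamma>) p @ [u])"
    using assms(1,2) q by auto
  then have "h = k" using path_no_loop[OF p, of h] assms(3,4) q by auto
  then have "walk \<Gamma> u p u" using p(1) assms(1,4) q by auto
  then have "p = []" using walk_first[of u p u] p(2) by (cases p) auto
  then show ?thesis using q \<open>h = k\<close> by simp
qed

text \<open>A repeated first edge must be taken in the opposite direction. That half-edge leaves the
  second vertex, so it is the second step, and it closes the walk.\<close>

lemma simple_closed_distinct_edges:
  assumes "walk \<Gamma> u q u" "distinct (map (endpt \<Gamma>) q)"
  obtains "distinct (map fst q)" | h where "q = [h, opp h]"
proof (cases q)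
  case (Cons h p)
  have p: "walk \<Gamma> (endpt \<Gamma> (opp h)) p u" "distinct (map (endpt \<Gamma>) p @ [u])"
    using assms Cons by auto
  show ?thesis
  proof (cases "fst h \<in> fst ` set p")
    case False
    then show ?thesis using path_distinct_edges[OF p] that(1) Cons by auto
  next
    case True
    then obtain k where k: "k \<in> set p" "fst h = fst k" by auto
    then have "k = opp h" using eq_or_opp[of h k] assms(2) Cons by auto
    obtain l p' where p': "p = l # p'" using k by (cases p) auto
    then have "endpt \<Gamma> l = endpt \<Gamma> k" using p(1) \<open>k = opp h\<close> by simp
    then have "l = k" using p(2) p' k(1) by force
    then have "walk \<Gamma> u p' u" using p(1) p' \<open>k = opp h\<close> assms(1) Cons by auto
    then have "p' = []" using walk_first[of u p' u] p(2) p' by (cases p') auto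
    then show ?thesis using that(2)[of h] Cons p' \<open>l = k\<close> \<open>k = opp h\<close> by simp
  qed
qed (use that in auto)

section \<open>Gains as signs and tension sums\<close>

lemma prod_sign_walk:
  assumes "walk \<Gamma> u p w"
  shows "(\<Prod>h\<leftarrow>p. \<sigma> (fst h)) = (if flip (gain p) then -1 else 1)"
  using assms
proof (induction p arbitrary: u)
  case (Cons h p)
  then show ?case using sign_cases[of "fst h"] by (auto simp: gain_Cons step_gain_def)
qed simp

lemma cycle_sign:
  assumes "walk \<Gamma> u p w" "distinct (map fst p)"
  shows "(\<Prod>e\<in>walk_edges p. \<sigma> e) = (if flip (gain p) then -1 else 1)"
  using prod_sign_walk[OF assms(1)] prod.distinct_set_conv_list[OF assms(2), of \<sigma>]
  by (simp add: walk_edges_def comp_def)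

lemma unbalanced_cycleI:
  assumes "walk \<Gamma> u q u" "q \<noteq> []" "distinct (map (endpt \<Gamma>) q)" "distinct (map fst q)" "flip (gain q)"
  shows "unbalanced_cycle \<Gamma> \<sigma> (walk_edges q)"
  using assms cycle_sign[OF assms(1,4)]
  by (auto simp: unbalanced_cycle_def is_cycle_def cycle_walk_def closed_walk_def)

lemma balanced_cycleI:
  assumes "walk \<Gamma> u q u" "q \<noteq> []" "distinct (map (endpt \<Gamma>) q)" "distinct (map fst q)"
    "\<not> flip (gain q)"
  shows "balanced_cycle \<Gamma> \<sigma> (walk_edges q)"
  using assms cycle_sign[OF assms(1,4)]
  by (auto simp: balanced_cycle_def is_cycle_def cycle_walk_def closed_walk_def)

text \<open>The first step multiplies the coefficients of all later terms by its sign, just as the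
  dihedral sum does with translation parts.\<close>

lemma transl_gain:
  assumes "walk \<Gamma> u p w"
  shows "(\<Sum>i<length p. (\<omega> (p ! i) * (\<Prod>j<i. \<sigma> (fst (p ! j)))) \<odot> f (fst (p ! i))) =
    transl (gain p)"
  using assms
proof (induction p arbitrary: u)
  case Nil
  then show ?case by (simp add: zero_gdih_def)
next
  case (Cons h p)
  let ?s = "\<lambda>i. \<omega> (p ! i) * (\<Prod>j<i. \<sigma> (fst (p ! j)))"
  have p: "walk \<Gamma> (endpt \<Gamma> (opp h)) p w" and h: "fst h \<in> edges \<Gamma>" using Cons.prems by auto
  \<comment> \<open>\<open>sign_act\<close> treats every integer other than 1 as -1, so it is
    multiplicative only once the coefficients are known to be signs.\<close>
  have sg: "?s i = 1 \<or> ?s i = -1" if "i < length p" for i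
  proof -
    have e: "fst (p ! j) \<in> edges \<Gamma>" if "j < length p" for j
      using walk_edges_subset[OF p] that by simp
    have "(\<Prod>j<k. \<sigma> (fst (p ! j))) = 1 \<or> (\<Prod>j<k. \<sigma> (fst (p ! j))) = -1" if "k \<le> length p" for k
      using that
    proof (induction k)
      case (Suc k)
      then show ?case using sign_cases[OF e[of k]] by auto
    qed simp
    from this[OF less_imp_le[OF that]] show ?thesis using orientation_cases[OF e[OF that]] by auto
  qed
  have "(\<Sum>i<length (h # p). (\<omega> ((h # p) ! i) * (\<Prod>j<i. \<sigma> (fst ((h # p) ! j)))) \<odot> f (fst ((h # p) ! i)))
     = \<omega> h \<odot> f (fst h) + (\<Sum>i<length p. (\<sigma> (fst h) * ?s i) \<odot> f (fst (p ! i)))"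
    by (simp add: sum.lessThan_Suc_shift prod.lessThan_Suc_shift mult.left_commute del: sum.lessThan_Suc prod.lessThan_Suc)
  also have "(\<Sum>i<length p. (\<sigma> (fst h) * ?s i) \<odot> f (fst (p ! i))) =
      (\<Sum>i<length p. \<sigma> (fst h) \<odot> (?s i \<odot> f (fst (p ! i))))"
  proof (rule sum.cong)
    fix i assume "i \<in> {..<length p}"
    then show "(\<sigma> (fst h) * ?s i) \<odot> f (fst (p ! i)) = \<sigma> (fst h) \<odot> (?s i \<odot> f (fst (p ! i)))"
      using sg[of i] sign_cases[OF h] by (auto simp: sign_act_def)
  qed simp
  also have "\<dots> = \<sigma> (fst h) \<odot> transl (gain p)"
    using sign_cases[OF h] Cons.IH[OF p] by (auto simp: sum_negf)
  finally show ?case using sign_cases[OF h]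
    by (auto simp: gain_Cons step_gain_def plus_gdih_def)
qed

lemma circuit_walk_gain:
  assumes "circuit_walk \<Gamma> \<sigma> c" "\<not> flip (gain c)"
  shows "gain c = 0"
proof -
  obtain v where "walk \<Gamma> v c v" using assms(1) by (auto simp: circuit_walk_def closed_walk_def)
  then have "transl (gain c) = 0"
    using assms(1) tension by (simp add: tension_def flip: transl_gain)
  then show ?thesis using assms(2) by (simp add: zero_gdih_def gdih.expand)
qed

text \<open>Besides balanced cycles this covers the empty walk and going back and forth along one
  edge, where the two gains cancel.\<close>

lemma simple_closed_gain:
  assumes "walk \<Gamma> u c u" "distinct (map (endpt \<Gamma>) c)" "\<not> flip (gain c)"
  shows "gain c = 0"
proof (cases "c = []")
  case False
  from simple_closed_distinct_edges[OF assms(1,2)] show ?thesis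
  proof cases
    case 1
    have "\<forall>e\<in>walk_edges c. count_list (map fst c) e = 1"
      using 1 by (auto simp: walk_edges_def count_list_distinct)
    then have "circuit_walk \<Gamma> \<sigma> c"
      using balanced_cycleI[OF assms(1) False assms(2) 1 assms(3)] False assms(1)
      unfolding circuit_walk_def circuit_def closed_walk_def
      by (intro conjI exI[of _ "walk_edges c"] exI[of _ "{}"]) auto
    then show ?thesis using circuit_walk_gain assms(3) by blast
  next
    case (2 h)
    then show ?thesis using assms(1) by (auto simp: gain_Cons step_gain_opp)
  qed
qed simp

section \<open>Balanced closed walks have trivial gain\<close>

definition null_below :: "nat \<Rightarrow> bool" where
  "null_below n \<longleftrightarrow>
     (\<forall>v c. walk \<Gamma> v c v \<and> length c < n \<and> \<not> flip (gain c) \<longrightarrow> gain c = 0)"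

lemma null_belowD:
  "null_below n \<Longrightarrow> walk \<Gamma> v c v \<Longrightarrow> length c < n \<Longrightarrow> \<not> flip (gain c) \<Longrightarrow> gain c = 0"
  unfolding null_below_def by blast

text \<open>\<open>a\<close> followed by the reverse of \<open>b\<close> is a balanced closed walk
  shorter than \<open>n\<close>.\<close>

lemma parallel_gain:
  assumes "null_below n" "walk \<Gamma> u a w" "walk \<Gamma> u b w" "length a + length b < n"
    "flip (gain a) = flip (gain b)"
  shows "gain a = gain b"
proof -
  have "gain (a @ wrev b) = 0"
    using assms by (intro null_belowD[OF assms(1)]) (auto intro!: walk_appendI walk_wrev simp: gain_wrev)
  then show ?thesis using gain_wrev[OF assms(3)] by simp
qed

text \<open>A lasso is a closed walk \<open>q\<close> with a walk \<open>z\<close> leading away to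
  \<open>w\<close>; seen from \<open>w\<close> its gain is a conjugate of \<open>gain q\<close>. A
  non-simple lasso shrinks with this conjugate unchanged. The count with \<open>z\<close> doubled is
  the length of the closed walk at \<open>w\<close>; it may stay constant when part of
  \<open>q\<close> moves into \<open>z\<close>, whereas the count with \<open>z\<close> taken once
  always drops.\<close>

lemma lasso_step:
  assumes nb: "null_below n"
    and q: "walk \<Gamma> u q u" "flip (gain q)"
    and z: "walk \<Gamma> u z w"
    and len: "length q + 2 * length z < n"
    and nonsimple: "\<not> (distinct (map (endpt \<Gamma>) q) \<and> distinct (map (endpt \<Gamma>) z @ [w]) \<and>
        endpt \<Gamma> ` set q \<inter> set (map (endpt \<Gamma>) z @ [w]) \<subseteq> {u})"
  obtains u' q' z' where "walk \<Gamma> u' q' u'" "flip (gain q')" "walk \<Gamma> u' z' w"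
    "length q' + 2 * length z' \<le> length q + 2 * length z"
    "length q' + length z' < length q + length z"
    "- gain z' + gain q' + gain z' = - gain z + gain q + gain z"
proof -
  consider "\<not> distinct (map (endpt \<Gamma>) q)"
    | "\<not> distinct (map (endpt \<Gamma>) z @ [w])"
    | t where "t \<in> endpt \<Gamma> ` set q" "t \<in> set (map (endpt \<Gamma>) z @ [w])" "t \<noteq> u"
    using nonsimple by blast
  then show thesis
  proof cases
    case 1
    from walk_repeat[OF q(1) this]
    obtain a b d t where s: "q = a @ b @ d" "b \<noteq> []" "walk \<Gamma> u a t" "walk \<Gamma> t b t"
      "walk \<Gamma> t d u" "d \<noteq> []" by metis
    show thesis
    proof (cases "flip (gain b)")
      case False
      then have "gain b = 0" using null_belowD[OF nb s(4)] len s by auto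
      then show thesis using s q z
        by (intro that[of u "a @ d" z] walk_appendI[OF s(3) s(5)]) auto
    next
      case True
      \<comment> \<open>\<open>q\<close> and \<open>b\<close> are both unbalanced, so
        \<open>a\<close> and the reversed \<open>d\<close> have equal sign; \<open>q\<close> is then
        \<open>b\<close> conjugated by either of them.\<close>
      have "gain a = gain (wrev d)"
        using s len q True
        by (intro parallel_gain[OF nb s(3) walk_wrev]) (auto simp: gain_wrev[OF s(5)])
      then have ga: "gain a = - gain d" by (simp add: gain_wrev[OF s(5)])
      show thesis
      \<comment> \<open>Moving the shorter of the two into \<open>z\<close> keeps the doubled count
        from growing.\<close>
      proof (cases "length a \<le> length d")
        case True
        have "length d > 0" using s by simp
        then show thesis using True \<open>flip (gain b)\<close>
          by (intro that[of t b "wrev a @ z"] s(4) walk_appendI[OF walk_wrev[OF s(3)] z])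
            (simp_all add: s(1) ga gain_wrev[OF s(3)] group_word del: add_uminus_conv_diff)
      next
        case False
        then show thesis using \<open>flip (gain b)\<close>
          by (intro that[of t b "d @ z"] s(4) walk_appendI[OF s(5) z])
            (auto simp add: s(1) ga group_word simp del: add_uminus_conv_diff)
      qed
    qed
  next
    case 2
    from walk_repeat_end[OF z this]
    obtain a b d t where s: "z = a @ b @ d" "b \<noteq> []" "walk \<Gamma> u a t" "walk \<Gamma> t b t"
      "walk \<Gamma> t d w" by metis
    \<comment> \<open>A balanced \<open>b\<close> is trivial. An unbalanced \<open>b\<close> has the
      gain of the parallel closed walk \<open>wrev a @ q @ a\<close>, and an element commutes with
      itself. Either way \<open>b\<close> can be cut out of \<open>z\<close>.\<close>
    have "- gain b + (- gain a + gain q + gain a) + gain b = - gain a + gain q + gain a"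
    proof (cases "flip (gain b)")
      case False
      then have "gain b = 0" using null_belowD[OF nb s(4)] len s by auto
      then show ?thesis by simp
    next
      case True
      have "gain b = gain (wrev a @ q @ a)"
      proof (rule parallel_gain[OF nb s(4)])
        show "walk \<Gamma> t (wrev a @ q @ a) t" 
          by (rule walk_appendI[OF walk_wrev[OF s(3)] walk_appendI[OF q(1) s(3)]])
      qed (use len q(2) True in \<open>auto simp: s(1) gain_wrev[OF s(3)]\<close>)
      then show ?thesis
        by (simp add: gain_wrev[OF s(3)] group_word del: add_uminus_conv_diff)
    qed
    then have "- gain d + (- gain b + (- gain a + gain q + gain a) + gain b) + gain d =
        - gain d + (- gain a + gain q + gain a) + gain d" by simp
    then show thesis using s(2)
      by (intro that[of u q "a @ d"] q walk_appendI[OF s(3) s(5)])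
        (simp_all add: s(1) group_word del: add_uminus_conv_diff)
  next
    case 3
    have "t \<in> set (map (endpt \<Gamma>) q @ [u])" using 3 by simp
    from walk_split_at[OF q(1) this]
    obtain q1 q2 where s: "q = q1 @ q2" "walk \<Gamma> u q1 t" "walk \<Gamma> t q2 u" by metis
    from walk_split_at[OF z 3(2)]
    obtain z1 z2 where r: "z = z1 @ z2" "walk \<Gamma> u z1 t" "walk \<Gamma> t z2 w" by metis
    have "z1 \<noteq> []" using r 3 by auto
    \<comment> \<open>\<open>q1\<close> and the reversed \<open>q2\<close> have opposite signs
      because \<open>q\<close> is unbalanced, so \<open>z1\<close> agrees with one of them.
      Conjugating by \<open>z1\<close> then merely rotates \<open>q\<close> to start at
      \<open>t\<close>.\<close>
    have "gain z1 = gain q1 \<or> gain z1 = gain (wrev q2)"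
    proof (cases "flip (gain z1) = flip (gain q1)")
      case True
      then show ?thesis using s r len parallel_gain[OF nb r(2) s(2)] by auto
    next
      case False
      then show ?thesis using s r len q parallel_gain[OF nb r(2) walk_wrev[OF s(3)]]
        by (auto simp: gain_wrev[OF s(3)])
    qed
    then have "- gain z1 + (gain q1 + gain q2) + gain z1 = gain q2 + gain q1"
      by (auto simp: gain_wrev[OF s(3)] group_word simp del: add_uminus_conv_diff)
    then have "- gain z2 + (- gain z1 + (gain q1 + gain q2) + gain z1) + gain z2 =
      - gain z2 + (gain q2 + gain q1) + gain z2" by simp
    then show thesis using q(2) \<open>z1 \<noteq> []\<close>
      by (intro that[of t "q2 @ q1" z2] r(3) walk_appendI[OF s(3) s(2)])
        (auto simp add: s(1) r(1) group_word simp del: add_uminus_conv_diff)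
  qed
qed

text \<open>With no repetition left, \<open>q @ z @ y @ wrev z\<close> walks around a tight handcuff
  (\<open>z\<close> empty) or a loose one, and the tension condition applies. The exception is that
  \<open>q\<close> and \<open>y\<close> run along the same loop; their gains are then inverse, since
  a reflection is an involution.\<close>

lemma simple_handcuff_gain:
  assumes q: "walk \<Gamma> u q u" "flip (gain q)" "distinct (map (endpt \<Gamma>) q)"
    and y: "walk \<Gamma> w y w" "flip (gain y)" "distinct (map (endpt \<Gamma>) y)"
    and z: "walk \<Gamma> u z w" "distinct (map (endpt \<Gamma>) z @ [w])"
    and qz: "endpt \<Gamma> ` set q \<inter> set (map (endpt \<Gamma>) z @ [w]) \<subseteq> {u}"
    and yz: "endpt \<Gamma> ` set y \<inter> set (map (endpt \<Gamma>) z @ [w]) \<subseteq> {w}"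
    and qy: "endpt \<Gamma> ` set q \<inter> endpt \<Gamma> ` set y \<subseteq> (if z = [] then {u} else {})"
  shows "gain q + gain z + gain y - gain z = 0"
proof -
  have ne: "q \<noteq> []" "y \<noteq> []" using q y by auto
  \<comment> \<open>Going back and forth along one edge has trivial gain, so it is not
    unbalanced.\<close>
  have dq: "distinct (map fst q)"
    using simple_closed_distinct_edges[OF q(1,3)] q(1,2)
    by cases (auto simp: gain_Cons step_gain_opp)
  have dy: "distinct (map fst y)"
    using simple_closed_distinct_edges[OF y(1,3)] y(1,2)
    by cases (auto simp: gain_Cons step_gain_opp)
  have dz: "distinct (map fst z)" using path_distinct_edges[OF z] .
  have uq: "u \<in> endpt \<Gamma> ` set q"
    using walk_first[OF q(1) ne(1)] hd_in_set[OF ne(1)] image_eqI by metis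
  have wy: "w \<in> endpt \<Gamma> ` set y"
    using walk_first[OF y(1) ne(2)] hd_in_set[OF ne(2)] image_eqI by metis
  let ?X = "walk_edges q" and ?Y = "walk_edges y" and ?P = "walk_edges z"
  let ?c = "q @ z @ y @ wrev z"
  have X: "unbalanced_cycle \<Gamma> \<sigma> ?X" and Y: "unbalanced_cycle \<Gamma> \<sigma> ?Y"
    using unbalanced_cycleI q y ne dq dy by auto
  have ends: "endpt \<Gamma> h \<in> edge_verts \<Gamma> A \<and> endpt \<Gamma> (opp h) \<in> edge_verts \<Gamma> A"
    if "fst h \<in> A" for h and A :: "'e set"
    using that by (cases h) (auto simp: edge_verts_def opp_def)
  have vX: "edge_verts \<Gamma> ?X = endpt \<Gamma> ` set q" and vY: "edge_verts \<Gamma> ?Y = endpt \<Gamma> ` set y"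
    using edge_verts_closed q(1) y(1) ne by auto
  have vP: "edge_verts \<Gamma> ?P \<subseteq> set (map (endpt \<Gamma>) z @ [w])"
    using edge_verts_walk[OF z(1)] by (cases "z = []") (auto simp: edge_verts_def walk_edges_def)
  \<comment> \<open>An edge shared by a cycle and the path would have both ends at their only common
    vertex, but a path contains no loop.\<close>
  have XP: "?X \<inter> ?P = {}" and YP: "?Y \<inter> ?P = {}"
  proof -
    have "fst h \<notin> ?X \<and> fst h \<notin> ?Y" if h: "h \<in> set z" for h
    proof -
      have hP: "fst h \<in> ?P" using h by (auto simp: walk_edges_def)
      have "fst h \<notin> A" if "edge_verts \<Gamma> A \<inter> set (map (endpt \<Gamma>) z @ [w]) \<subseteq> {x}" for A x
      proof
        assume hA: "fst h \<in> A"
        have "endpt \<Gamma> h \<in> {x}" "endpt \<Gamma> (opp h) \<in> {x}"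
          by (rule subsetD[OF that], use ends[OF hA] ends[OF hP] vP in blast)+
        then show False using path_no_loop[OF z h] by simp
      qed
      then show ?thesis using qz yz unfolding vX[symmetric] vY[symmetric] by blast
    qed
    then show "?X \<inter> ?P = {}" "?Y \<inter> ?P = {}" by (auto simp: walk_edges_def[of z])
  qed
  have closed: "walk \<Gamma> u ?c u" by (intro walk_appendI[OF q(1)] walk_appendI[OF z(1)]
      walk_appendI[OF y(1)] walk_wrev[OF z(1)])
  have gc: "gain ?c = gain q + gain z + gain y - gain z"
    by (simp add: gain_wrev[OF z(1)] group_word del: add_uminus_conv_diff)
  have edges: "walk_edges ?c = ?X \<union> ?Y \<union> ?P"
    by auto
  show ?thesis
  proof (cases "?X \<inter> ?Y = {}")
    case False
    then obtain h k where hk: "h \<in> set q" "k \<in> set y" "fst h = fst k"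
      by (auto simp: walk_edges_def)
    have h: "fst h \<in> ?X" "fst h \<in> ?Y"
      using imageI[OF hk(1), of fst] imageI[OF hk(2), of fst] hk(3)
      by (simp_all add: walk_edges_def)
    have k: "fst k \<in> ?X" "fst k \<in> ?Y" using hk h by auto
    have "z = []" "u = w" using ends[OF h(1)] ends[OF h(2)] qy z(1) unfolding vX vY
      by (auto split: if_splits)
    have "endpt \<Gamma> (opp h) = endpt \<Gamma> h" "endpt \<Gamma> (opp k) = endpt \<Gamma> k"
      using ends[OF h(1)] ends[OF h(2)] ends[OF k(1)] ends[OF k(2)] qy \<open>z = []\<close>
      unfolding vX vY by auto
    then have "q = [h]" "y = [k]"
      using simple_closed_loop[OF q(1,3) hk(1)] simple_closed_loop[OF y(1,3) hk(2)] by auto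
    moreover have "k = h \<or> k = opp h" using hk(3) by (rule eq_or_opp)
    ultimately have "gain q + gain y = 0"
      using q(1,2) flip_add_self[of "gain q"] by (auto simp: gain_Cons step_gain_opp)
    then show ?thesis using \<open>z = []\<close> by simp
  next
    case XY: True
    have cnt: "count_list (map fst ?c) e = (if e \<in> ?P then 2 else 1)" if "e \<in> ?X \<union> ?Y \<union> ?P" for e
      using that XP YP XY count_list_distinct[OF dq, of e] count_list_distinct[OF dy, of e]
        count_list_distinct[OF dz, of e]
      by (auto simp: map_fst_wrev walk_edges_def)
    have "circuit \<Gamma> \<sigma> (?X \<union> ?Y \<union> ?P) ?P"
    proof (cases "z = []")
      case True
      then have "u = w" using z(1) by simp
      have "?X \<noteq> ?Y" using XY ne by (auto simp: walk_edges_def)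
      moreover have "edge_verts \<Gamma> ?X \<inter> edge_verts \<Gamma> ?Y = {u}"
        using qy True uq wy \<open>u = w\<close> unfolding vX vY by auto
      ultimately have "tight_handcuff \<Gamma> \<sigma> (?X \<union> ?Y)"
        unfolding tight_handcuff_def using X Y by blast
      then show ?thesis using True by (simp add: circuit_def walk_edges_def)
    next
      case False
      have vz: "edge_verts \<Gamma> ?P = set (map (endpt \<Gamma>) z @ [w])" by (rule edge_verts_walk[OF z(1) False])
      have "edge_verts \<Gamma> ?X \<inter> edge_verts \<Gamma> ?Y = {}" using qy False unfolding vX vY by simp
      moreover have "edge_verts \<Gamma> ?P \<inter> edge_verts \<Gamma> ?X = {u}"
        using qz uq walk_start[OF z(1)] unfolding vX vz by blast
      moreover have "edge_verts \<Gamma> ?P \<inter> edge_verts \<Gamma> ?Y = {w}"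
        using yz wy unfolding vY vz by auto
      moreover have "path \<Gamma> u z w" using z by (simp add: path_def)
      ultimately have "loose_handcuff \<Gamma> \<sigma> (?X \<union> ?Y \<union> ?P) ?P"
        unfolding loose_handcuff_def using X Y by blast
      then show ?thesis by (simp add: circuit_def)
    qed
    then have "circuit_walk \<Gamma> \<sigma> ?c"
      unfolding circuit_walk_def closed_walk_def edges using closed cnt ne by blast
    moreover have "\<not> flip (gain ?c)" unfolding gc using q(2) y(2) by simp
    ultimately show ?thesis using circuit_walk_gain unfolding gc[symmetric] by blast
  qed
qed

text \<open>The handcuff walk may have length \<open>n\<close>, just beyond the hypothesis, but only
  parts of smaller total length are compared. The inner induction counts \<open>z\<close> once, the
  measure that \<open>lasso_step\<close> decreases; the end at \<open>y\<close> is treated as a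
  lasso with \<open>z\<close> reversed.\<close>

lemma handcuff_gain:
  assumes nb: "null_below n"
    and "walk \<Gamma> u q u" "flip (gain q)" "walk \<Gamma> w y w" "flip (gain y)" "walk \<Gamma> u z w"
    and "length q + 2 * length z + length y \<le> n"
  shows "gain q + gain z + gain y - gain z = 0"
  using assms(2-)
proof (induction "length q + length z + length y" arbitrary: u q w y z rule: less_induct)
  case less
  note q = less.prems(1,2) and y = less.prems(3,4) and z = less.prems(5) and len = less.prems(6)
  have ne: "q \<noteq> []" "y \<noteq> []" using q y by auto
  have rz: "walk \<Gamma> w (wrev z) u" using walk_wrev[OF z] .
  have verts_rz: "set (map (endpt \<Gamma>) (wrev z) @ [u]) = set (map (endpt \<Gamma>) z @ [w])"
  proof (cases "z = []")
    case False
    then have "wrev z \<noteq> []" by (simp add: wrev_def)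
    then show ?thesis using edge_verts_walk[OF z False] edge_verts_walk[OF rz] by simp
  qed (use z in auto)
  let ?L = "distinct (map (endpt \<Gamma>) q) \<and> distinct (map (endpt \<Gamma>) z @ [w]) \<and>
        endpt \<Gamma> ` set q \<inter> set (map (endpt \<Gamma>) z @ [w]) \<subseteq> {u}"
    and ?R = "distinct (map (endpt \<Gamma>) y) \<and> distinct (map (endpt \<Gamma>) (wrev z) @ [u]) \<and>
        endpt \<Gamma> ` set y \<inter> set (map (endpt \<Gamma>) (wrev z) @ [u]) \<subseteq> {w}"
    and ?M = "endpt \<Gamma> ` set q \<inter> endpt \<Gamma> ` set y \<subseteq> (if z = [] then {u} else {})"
  consider (left) "\<not> ?L" | (right) "\<not> ?R" | (meet) "\<not> ?M" | (simple) ?L ?R ?M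
    by argo
  then show ?case
  proof cases
    case left
    have "length q + 2 * length z < n" using len ne by (cases y) auto
    from lasso_step[OF nb q z this left]
    obtain u' q' z' where r: "walk \<Gamma> u' q' u'" "flip (gain q')" "walk \<Gamma> u' z' w"
      "length q' + 2 * length z' \<le> length q + 2 * length z"
      "length q' + length z' < length q + length z"
      "- gain z' + gain q' + gain z' = - gain z + gain q + gain z" by metis
    have "gain q' + gain z' + gain y - gain z' = 0"
      using r len by (intro less.hyps[OF _ r(1,2) y r(3)]) auto
    then have "- gain z' + (gain q' + gain z' + gain y - gain z') + gain z' = 0" by simp
    then have "(- gain z' + gain q' + gain z') + gain y = 0"
      by (simp add: group_word del: add_uminus_conv_diff)
    then have "gain z + ((- gain z + gain q + gain z) + gain y) - gain z = 0" unfolding r(6) by simp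
    then show ?thesis by (simp add: group_word del: add_uminus_conv_diff)
  next
    case right
    have "length y + 2 * length (wrev z) < n" using len ne by (cases q) auto
    from lasso_step[OF nb y rz this right]
    obtain w' y' z' where r: "walk \<Gamma> w' y' w'" "flip (gain y')" "walk \<Gamma> w' z' u"
      "length y' + 2 * length z' \<le> length y + 2 * length (wrev z)"
      "length y' + length z' < length y + length (wrev z)"
      "- gain z' + gain y' + gain z' = - gain (wrev z) + gain y + gain (wrev z)" by metis
    have "gain q + gain (wrev z') + gain y' - gain (wrev z') = 0"
      using r len by (intro less.hyps[OF _ q r(1,2) walk_wrev[OF r(3)]]) auto
    then have "gain q + (- gain z' + gain y' + gain z') = 0"
      by (simp add: gain_wrev[OF r(3)] group_word del: add_uminus_conv_diff)
    then show ?thesis unfolding r(6)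
      by (simp add: gain_wrev[OF z] group_word del: add_uminus_conv_diff)
  next
    case notsub: meet
    then obtain t where meet: "t \<in> endpt \<Gamma> ` set q" "t \<in> endpt \<Gamma> ` set y" "z = [] \<Longrightarrow> t \<noteq> u"
      by (auto split: if_splits)
    have "t \<in> set (map (endpt \<Gamma>) q @ [u])" using meet by simp
    from walk_split_at[OF q(1) this]
    obtain q1 q2 where s: "q = q1 @ q2" "walk \<Gamma> u q1 t" "walk \<Gamma> t q2 u" "q2 \<noteq> []"
      using meet by metis
    have "t \<in> set (map (endpt \<Gamma>) y @ [w])" using meet by simp
    from walk_split_at[OF y(1) this]
    obtain y1 y2 where r: "y = y1 @ y2" "walk \<Gamma> w y1 t" "walk \<Gamma> t y2 w" "y2 \<noteq> []"
      using meet by metis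
    \<comment> \<open>When \<open>z\<close> is empty, \<open>t\<close> differs from the common base
      vertex, so \<open>q1\<close> and \<open>y1\<close> are nonempty; this keeps each pair of
      compared walks below \<open>n\<close>.\<close>
    have pos: "length z + length q1 > 0" using meet(3) s(2) by auto
    have pos2: "length q2 > 0" "length y2 > 0" using s r by auto
    have w1: "walk \<Gamma> u (z @ y1) t" and w2: "walk \<Gamma> u (z @ wrev y2) t" and w3: "walk \<Gamma> u (wrev q2) t"
      using s r z by (auto intro: walk_appendI walk_wrev)
    have gq: "gain q = gain q1 - gain (wrev q2)" by (simp add: s(1) gain_wrev[OF s(3)])
    have y2: "gain (wrev y2) = - gain y2" by (rule gain_wrev[OF r(3)])
    have pm: "length z + length y1 > 0" using meet(3) r(2) z by (cases z) auto
    have lt: "length q1 + length (z @ y1) < n" "length (wrev q2) + length (z @ wrev y2) < n"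
      "length q1 + length (z @ wrev y2) < n" "length (wrev q2) + length (z @ y1) < n"
      using len pos pos2 pm unfolding s(1) r(1) length_append length_wrev by linarith+
    show ?thesis
    \<comment> \<open>\<open>q1\<close> and the reversed \<open>q2\<close> have opposite signs, as
      do \<open>z @ y1\<close> and \<open>z @ wrev y2\<close>, so these walks from \<open>u\<close>
      to \<open>t\<close> match in pairs by sign. One matching makes \<open>gain q\<close> equal to
      the conjugate of \<open>gain y\<close> by \<open>gain z\<close>, and a reflection squares to
      zero; the other makes it the inverse of that conjugate.\<close>
    proof (cases "flip (gain q1) = flip (gain (z @ y1))")
      case True
      have "gain q1 = gain (z @ y1)"
        using True by (rule parallel_gain[OF nb s(2) w1 lt(1)])
      moreover have "gain (wrev q2) = gain (z @ wrev y2)"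
        using True q(2) y(2) s(1) r(1)
        by (intro parallel_gain[OF nb w3 w2 lt(2)]) (auto simp: gain_wrev[OF s(3)] y2)
      ultimately have "gain q = gain z + gain y - gain z"
        unfolding gq by (simp add: r(1) y2 group_word del: add_uminus_conv_diff)
      then show ?thesis using flip_add_self[OF q(2)]
        by (simp add: group_word del: add_uminus_conv_diff)
    next
      case False
      have "gain q1 = gain (z @ wrev y2)"
        using False q(2) y(2) s(1) r(1)
        by (intro parallel_gain[OF nb s(2) w2 lt(3)]) (auto simp: y2)
      moreover have "gain (wrev q2) = gain (z @ y1)"
        using False q(2) y(2) s(1) r(1)
        by (intro parallel_gain[OF nb w3 w1 lt(4)]) (auto simp: gain_wrev[OF s(3)])
      ultimately show ?thesis
        unfolding gq by (simp add: r(1) y2 group_word del: add_uminus_conv_diff)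
    qed
  next
    case simple
    note L = simple(1) and R = simple(2)[unfolded verts_rz]
    show ?thesis
      by (rule simple_handcuff_gain[OF q conjunct1[OF L] y conjunct1[OF R] z
          conjunct1[OF conjunct2[OF L]] conjunct2[OF conjunct2[OF L]]
          conjunct2[OF conjunct2[OF R]] simple(3)])
  qed
qed

lemma null_below_all: "null_below n"
proof (induction n)
  case 0
  then show ?case by (simp add: null_below_def)
next
  case (Suc n)
  have "gain c = 0" if c: "walk \<Gamma> v c v" "length c < Suc n" "\<not> flip (gain c)" for v c
  proof (cases "distinct (map (endpt \<Gamma>) c)")
    case True
    then show ?thesis using simple_closed_gain c by blast
  next
    case False
    from walk_repeat[OF c(1) False]
    obtain a b d t where s: "c = a @ b @ d" "b \<noteq> []" "d \<noteq> []"
      "walk \<Gamma> v a t" "walk \<Gamma> t b t" "walk \<Gamma> t d v" by metis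
    have da: "walk \<Gamma> t (d @ a) t" using walk_appendI[OF s(6,4)] .
    have "length b > 0" "length d > 0" using s by auto
    then have lt: "length b < n" "length (d @ a) < n" using c(2)
      unfolding s(1) length_append by linarith+
    \<comment> \<open>Rotating \<open>c\<close> to start at \<open>t\<close> conjugates its gain.
      The two closed walks have equal sign: both are balanced and covered by the induction, or they
      form a handcuff with empty path.\<close>
    have "gain b + gain (d @ a) = 0"
    proof (cases "flip (gain b)")
      case True
      have "gain b + gain [] + gain (d @ a) - gain [] = 0"
        using c(2,3) s(1) True walk_in_verts[OF s(4)]
        by (intro handcuff_gain[OF Suc.IH s(5) True da]) auto
      then show ?thesis by simp
    next
      case False
      have "gain b = 0" "gain (d @ a) = 0"
        using c(3) s(1) False null_belowD[OF Suc.IH s(5) lt(1)] null_belowD[OF Suc.IH da lt(2)]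
        by auto
      then show ?thesis by simp
    qed
    then have "gain a + (gain b + gain (d @ a)) - gain a = 0" by simp
    then show ?thesis by (simp add: s(1) group_word del: add_uminus_conv_diff)
  qed
  then show ?case unfolding null_below_def by blast
qed

section \<open>Closed walks modulo doubles\<close>

lemma gain_unique:
  assumes "walk \<Gamma> u a w" "walk \<Gamma> u b w" "flip (gain a) = flip (gain b)"
  shows "gain a = gain b"
  using parallel_gain[OF null_below_all assms(1,2) lessI assms(3)] .

text \<open>Every coefficient in the translation part is a sign, and signs disappear modulo
  doubles.\<close>

lemma transl_gain_parity:
  assumes "walk \<Gamma> u p w"
  shows "transl (gain p) - (\<Sum>h\<leftarrow>p. f (fst h)) \<in> twice"
  using assms
proof (induction p arbitrary: u)
  case Nil
  then show ?case by (simp add: zero_gdih_def)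
next
  case (Cons h p)
  let ?x = "f (fst h)" and ?t = "transl (gain p)" and ?S = "\<Sum>h\<leftarrow>p. f (fst h)"
  have IH: "?t - ?S \<in> twice" and h: "fst h \<in> edges \<Gamma>" using Cons by auto
  have t: "transl (gain (h # p)) = \<omega> h \<odot> ?x + \<sigma> (fst h) \<odot> ?t"
    using sign_cases[OF h] by (auto simp: gain_Cons step_gain_def plus_gdih_def)
  from twice_add[OF twice_add[OF sign_act_diff_twice sign_act_diff_twice] IH]
  have "(\<omega> h \<odot> ?x - ?x) + (\<sigma> (fst h) \<odot> ?t - ?t) + (?t - ?S) \<in> twice" .
  also have "(\<omega> h \<odot> ?x - ?x) + (\<sigma> (fst h) \<odot> ?t - ?t) + (?t - ?S) =
      transl (gain (h # p)) - (\<Sum>h\<leftarrow>h # p. f (fst h))"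
    unfolding t by (simp add: algebra_simps)
  finally show ?case .
qed

lemma sum_walk_edges:
  "distinct (map fst p) \<Longrightarrow> (\<Sum>e\<in>walk_edges p. f e) = (\<Sum>h\<leftarrow>p. f (fst h))"
  by (simp add: walk_edges_def sum.distinct_set_conv_list comp_def flip: set_map)

text \<open>An unbalanced closed walk at a given vertex need not be a cycle. Splitting at repeated
  vertices leads to simple closed walks, which are unbalanced cycles or have trivial gain.\<close>

lemma closed_walk_sum_twice:
  assumes cyc: "\<And>X. unbalanced_cycle \<Gamma> \<sigma> X \<Longrightarrow> (\<Sum>e\<in>X. f e) \<in> twice"
    and "walk \<Gamma> v c v"
  shows "(\<Sum>h\<leftarrow>c. f (fst h)) \<in> twice"
  using assms(2)
proof (induction "length c" arbitrary: v c rule: less_induct)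
  case less
  note c = less.prems
  show ?case
  proof (cases "distinct (map (endpt \<Gamma>) c)")
    case False
    from walk_repeat[OF c False]
    obtain a b d t where s: "c = a @ b @ d" "b \<noteq> []" "d \<noteq> []"
      "walk \<Gamma> v a t" "walk \<Gamma> t b t" "walk \<Gamma> t d v" by metis
    have "(\<Sum>h\<leftarrow>b. f (fst h)) \<in> twice" "(\<Sum>h\<leftarrow>a @ d. f (fst h)) \<in> twice"
      using s by (auto intro!: less.hyps[OF _ s(5)] less.hyps[OF _ walk_appendI[OF s(4,6)]]
          simp del: sum_list_append map_append)
    from twice_add[OF this] show ?thesis by (simp add: s(1) algebra_simps)
  next
    case simple: True
    show ?thesis
    proof (cases "flip (gain c)")
      case False
      then have "gain c = 0" using simple_closed_gain[OF c simple] by simp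
      then show ?thesis using twice_uminus[OF transl_gain_parity[OF c]] by (simp add: zero_gdih_def)
    next
      case True
      then have "c \<noteq> []" by auto
      from simple_closed_distinct_edges[OF c simple] show ?thesis
      proof cases
        case 1
        then show ?thesis
          using cyc[OF unbalanced_cycleI[OF c \<open>c \<noteq> []\<close> simple 1 True]] sum_walk_edges[OF 1] by simp
      qed simp
    qed
  qed
qed

section \<open>Construction of a potential\<close>

text \<open>An unbalanced closed walk acts as \<open>x \<mapsto> t - x\<close>, which fixes the
  halves of \<open>t\<close>, and all others at \<open>r\<close> share its gain. If \<open>r\<close>
  lies in a balanced component, all gains at \<open>r\<close> are trivial and any \<open>x\<close>
  will do.\<close>

lemma fixed_potential:
  assumes cyc: "\<And>X. unbalanced_cycle \<Gamma> \<sigma> X \<Longrightarrow> (\<Sum>e\<in>X. f e) \<in> twice"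
  shows "\<exists>x. \<forall>c. walk \<Gamma> r c r \<longrightarrow> act (gain c) x = x"
proof (cases "\<exists>c. walk \<Gamma> r c r \<and> flip (gain c)")
  case True
  then obtain c where c: "walk \<Gamma> r c r" "flip (gain c)" by blast
  have "transl (gain c) \<in> twice"
    using twice_add[OF transl_gain_parity[OF c(1)] closed_walk_sum_twice[OF cyc c(1)]] by simp
  then obtain x where x: "transl (gain c) = x + x" by (auto simp: twice_def)
  have "act (gain d) x = x" if d: "walk \<Gamma> r d r" for d
  proof (cases "flip (gain d)")
    case True
    then have "gain d = gain c" using gain_unique[OF d c(1)] c(2) by simp
    then show ?thesis using c(2) x by (simp add: act_def)
  next
    case False
    then have "gain d = gain []" using gain_unique[OF d, of "[]"] walk_in_verts[OF d] by simp
    then show ?thesis by simp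
  qed
  then show ?thesis by blast
next
  case False
  have "act (gain d) x = x" if d: "walk \<Gamma> r d r" for d x
  proof -
    have "gain d = gain []" using gain_unique[OF d, of "[]"] walk_in_verts[OF d] False d by auto
    then show ?thesis by simp
  qed
  then show ?thesis by blast
qed

lemma potential_exists:
  assumes cyc: "\<And>X. unbalanced_cycle \<Gamma> \<sigma> X \<Longrightarrow> (\<Sum>e\<in>X. f e) \<in> twice"
  shows "\<exists>g. \<forall>h. fst h \<in> edges \<Gamma> \<longrightarrow> g (endpt \<Gamma> h) = act (step_gain h) (g (endpt \<Gamma> (opp h)))"
proof -
  \<comment> \<open>One root per component: \<open>root v\<close> depends on \<open>v\<close> only
    through the reachable set \<open>R v\<close>, so both ends of an edge get the same root.\<close>
  define R where "R v = {w. \<exists>p. walk \<Gamma> v p w}" for v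
  define root where "root v = (SOME w. w \<in> R v)" for v
  obtain x where x: "\<And>r c. walk \<Gamma> r c r \<Longrightarrow> act (gain c) (x r) = x r"
    using fixed_potential[OF cyc] by metis
  \<comment> \<open>Two walks to \<open>r\<close> differ by a closed walk at \<open>r\<close>, which
    fixes \<open>x r\<close>, so the choice of walk does not matter.\<close>
  have ind: "act (gain p) (x r) = act (gain p') (x r)" if "walk \<Gamma> v p r" "walk \<Gamma> v p' r" for v p p' r
  proof -
    have "walk \<Gamma> r (wrev p' @ p) r" using that by (auto intro: walk_appendI walk_wrev)
    then have "act (gain p') (act (gain (wrev p' @ p)) (x r)) = act (gain p') (x r)"
      by (simp only: x)
    moreover have "gain p' + gain (wrev p' @ p) = gain p"
      using gain_wrev[OF that(2)] by simp
    ultimately show ?thesis by (metis act_plus)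
  qed
  define g where "g v = act (gain (SOME p. walk \<Gamma> v p (root v))) (x (root v))" for v
  have g: "g v = act (gain p) (x (root v))" if "walk \<Gamma> v p (root v)" for v p
    unfolding g_def using someI[of "\<lambda>p. walk \<Gamma> v p (root v)", OF that] that by (rule ind)
  have "g (endpt \<Gamma> h) = act (step_gain h) (g (endpt \<Gamma> (opp h)))" if h: "fst h \<in> edges \<Gamma>" for h
  proof -
    let ?u = "endpt \<Gamma> h" and ?v = "endpt \<Gamma> (opp h)"
    have uv: "walk \<Gamma> ?u [h] ?v" using h endpt_in_verts[of "opp h"] by simp
    have "R ?u = R ?v"
      unfolding R_def using walk_appendI[OF uv] walk_appendI[OF walk_wrev[OF uv]] by blast
    then have root: "root ?u = root ?v" by (simp add: root_def)
    have "?v \<in> R ?v" unfolding R_def using endpt_in_verts[of "opp h"] h by (auto intro: exI[of _ "[]"])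
    then have "root ?v \<in> R ?v" unfolding root_def by (rule someI)
    then obtain p where p: "walk \<Gamma> ?v p (root ?v)" by (auto simp: R_def)
    have hp: "walk \<Gamma> ?u (h # p) (root ?u)" using p h root by simp
    show ?thesis using g[OF hp] g[OF p] root by (simp add: gain_Cons act_plus)
  qed
  then show ?thesis by blast
qed

lemma image_deltaI:
  assumes cyc: "\<And>X. unbalanced_cycle \<Gamma> \<sigma> X \<Longrightarrow> (\<Sum>e\<in>X. f e) \<in> twice"
  shows "f \<in> delta \<Gamma> \<omega> ` (verts \<Gamma> \<rightarrow>\<^sub>E UNIV)"
proof -
  obtain g where g: "\<And>h. fst h \<in> edges \<Gamma> \<Longrightarrow>
      g (endpt \<Gamma> h) = act (step_gain h) (g (endpt \<Gamma> (opp h)))"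
    using potential_exists[OF cyc] by blast
  have "f e = delta \<Gamma> \<omega> (restrict g (verts \<Gamma>)) e" for e
  proof (cases "e \<in> edges \<Gamma>")
    case True
    have verts: "endpt \<Gamma> (e, b) \<in> verts \<Gamma>" for b using endpt_in_verts[of "(e, b)"] True by simp
    \<comment> \<open>Multiplied by \<open>\<omega> (e, True)\<close>, this becomes the edge
      equation of \<open>delta\<close> by compatibility.\<close>
    have "g (endpt \<Gamma> (e, True)) = \<omega> (e, True) \<odot> f e + \<sigma> e \<odot> g (endpt \<Gamma> (e, False))"
      using g[of "(e, True)"] True sign_cases[OF True]
      by (auto simp: act_def step_gain_def opp_def)
    moreover have "\<sigma> e = - (\<omega> (e, False) * \<omega> (e, True))"
      using compatible True by (auto simp: compatible_orientation_def)
    ultimately show ?thesis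
      using orientation_cases[of "(e, True)"] orientation_cases[of "(e, False)"] True verts
      by (auto simp: delta_def)
  next
    case False
    then show ?thesis using tension by (auto simp: tension_def delta_def)
  qed
  then have "f = delta \<Gamma> \<omega> (restrict g (verts \<Gamma>))" by blast
  then show ?thesis by auto
qed

section \<open>Necessity of the cycle condition\<close>

text \<open>Modulo doubles \<open>f\<close> is the sum of the potential at the two ends of an edge,
  so along a walk interior vertices are counted twice and only the ends remain, which coincide for a
  closed walk.\<close>

lemma image_deltaD:
  assumes "f \<in> delta \<Gamma> \<omega> ` (verts \<Gamma> \<rightarrow>\<^sub>E UNIV)" and c: "walk \<Gamma> v c v"
  shows "(\<Sum>h\<leftarrow>c. f (fst h)) \<in> twice"
proof -
  obtain g where f: "f = delta \<Gamma> \<omega> g" using assms(1) by blast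
  have edge: "f (fst h) - (g (endpt \<Gamma> h) + g (endpt \<Gamma> (opp h))) \<in> twice" if h: "fst h \<in> edges \<Gamma>" for h
  proof -
    have "f (fst h) = \<omega> h \<odot> g (endpt \<Gamma> h) + \<omega> (opp h) \<odot> g (endpt \<Gamma> (opp h))"
      using h unfolding f by (cases h; cases "snd h") (auto simp: delta_def opp_def add.commute)
    then have "f (fst h) - (g (endpt \<Gamma> h) + g (endpt \<Gamma> (opp h))) =
      (\<omega> h \<odot> g (endpt \<Gamma> h) - g (endpt \<Gamma> h)) +
      (\<omega> (opp h) \<odot> g (endpt \<Gamma> (opp h)) - g (endpt \<Gamma> (opp h)))"
      by (simp add: algebra_simps)
    then show ?thesis by (simp only: twice_add sign_act_diff_twice)
  qed
  have "(\<Sum>h\<leftarrow>p. f (fst h)) - (g u + g w) \<in> twice" if "walk \<Gamma> u p w" for u p w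
    using that
  proof (induction p arbitrary: u)
    case Nil
    then show ?case using twice_uminus[OF twice_self[of "g w"]] by simp
  next
    case (Cons h p)
    let ?m = "endpt \<Gamma> (opp h)"
    have "(\<Sum>h\<leftarrow>p. f (fst h)) - (g ?m + g w) \<in> twice" using Cons by simp
    from twice_add[OF twice_add[OF edge[of h] this] twice_self[of "g ?m"]] Cons.prems
    show ?case by (simp add: algebra_simps)
  qed
  from twice_add[OF this[OF c] twice_self[of "g v"]] show ?thesis by simp
qed

lemma image_delta_iff:
  "f \<in> delta \<Gamma> \<omega> ` (verts \<Gamma> \<rightarrow>\<^sub>E UNIV) \<longleftrightarrow>
     (\<forall>X. unbalanced_cycle \<Gamma> \<sigma> X \<longrightarrow> (\<Sum>e\<in>X. f e) \<in> twice)"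
proof
  assume f: "f \<in> delta \<Gamma> \<omega> ` (verts \<Gamma> \<rightarrow>\<^sub>E UNIV)"
  show "\<forall>X. unbalanced_cycle \<Gamma> \<sigma> X \<longrightarrow> (\<Sum>e\<in>X. f e) \<in> twice"
    using image_deltaD[OF f] sum_walk_edges
    by (auto simp: unbalanced_cycle_def is_cycle_def cycle_walk_def closed_walk_def)
qed (use image_deltaI in blast)

lemma potential_difference_iff:
  "potential_difference \<Gamma> \<sigma> \<omega> f \<longleftrightarrow>
     (\<forall>X. unbalanced_cycle \<Gamma> \<sigma> X \<longrightarrow> (\<Sum>e\<in>X. f e) \<in> twice)"
proof -
  have "(\<Sum>i<length c. f (fst (c ! i))) = (\<Sum>e\<in>walk_edges c. f e)" if "cycle_walk \<Gamma> c" for c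
    using that sum_walk_edges[of c]
    by (simp add: cycle_walk_def sum_list_sum_nth atLeast0LessThan)
  then show ?thesis
    using tension unfolding potential_difference_def unbalanced_cycle_def is_cycle_def by auto
qed

end

theorem theorem7p14:
  fixes \<Gamma> :: "('v, 'e) multigraph"
    and \<sigma> :: "'e \<Rightarrow> int"
    and \<omega> :: "'e half_edge \<Rightarrow> int"
    and f :: "'e \<Rightarrow> 'g::{ab_group_add, finite}"
  assumes "signed_graph \<Gamma> \<sigma>"
    and "unbalanced \<Gamma> \<sigma>"
    and "compatible_orientation \<Gamma> \<sigma> \<omega>"
    and "tension \<Gamma> \<sigma> \<omega> f"
  shows "(f \<in> delta \<Gamma> \<omega> ` (verts \<Gamma> \<rightarrow>\<^sub>E UNIV) \<longleftrightarrow>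
            (\<forall>X. unbalanced_cycle \<Gamma> \<sigma> X \<longrightarrow> (\<Sum>e\<in>X. f e) \<in> twice)) \<and>
         (f \<in> delta \<Gamma> \<omega> ` (verts \<Gamma> \<rightarrow>\<^sub>E UNIV) \<longleftrightarrow> potential_difference \<Gamma> \<sigma> \<omega> f)"
proof -
  interpret tension_graph \<Gamma> \<sigma> \<omega> f
    using assms by unfold_locales
  show ?thesis using image_delta_iff potential_difference_iff by blast
qed

end
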